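(* Let $X\sim E(\mu,\Sigma)$ where $\Sigma$ is the inverse of an M-matrix. Then $\operatorname{corr}(g(X_i),X_j\mid X_C)\ge 0$ for every $i,j\in V$, any increasing function $g:\mathbb{R}\to\mathbb{R}$ (for which this conditional correlation is defined), and any conditioning set $C\subseteq V\setminus\{i,j\}$.
   Context: A random vector $X=(X_1,\dots,X_d)$ has an elliptical distribution, written $X\sim E(\mu,\Sigma)$, if its characteristic function has the form $\boldsymbol t\mapsto \phi(\boldsymbol t^T\Sigma \boldsymbol t)\exp(i\mu^T \boldsymbol t)$ for some $\phi:[0,\infty)\to\mathbb{R}$, where $\mu\in\mathbb{R}^d$ and $\Sigma$ is a $d\times d$ symmetric matrix; $\phi$ is left implicit. Standing assumptions: $\Sigma$ is positive definite and, in the stochastic representation $X=\mu+\xi\,\Sigma^{1/2}U$ with $U$ uniform on the unit sphere of $\mathbb{R}^d$, $\xi\ge 0$ and $\xi$ independent of $U$, one has $0<\mathbb{E}\xi^2<\infty$. Put $V=\{1,\dots,d\}$. A symmetric positive definite matrix $K$ is an M-matrix if $K_{ij}\le 0$ for all $i\ne j$. $X_C$ is the subvector of $X$ with coordinates in $C$; conditioning on $X_\emptyset$ means no conditioning. "Increasing" means non-decreasing. *)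

theory Defs
  imports "HOL-Probability.Probability"
begin

subsection \<open>Matrices\<close>

definition pos_def_matrix :: "real^'n^'n \<Rightarrow> bool" where
  "pos_def_matrix A \<longleftrightarrow> transpose A = A \<and> (\<forall>x. x \<noteq> 0 \<longrightarrow> 0 < x \<bullet> (A *v x))"

definition M_matrix :: "real^'n^'n \<Rightarrow> bool" where
  "M_matrix K \<longleftrightarrow> pos_def_matrix K \<and> (\<forall>i j. i \<noteq> j \<longrightarrow> K $ i $ j \<le> 0)"

subsection \<open>Elliptical distributions\<close>

definition char_fun :: "'a measure \<Rightarrow> ('a \<Rightarrow> real^'n) \<Rightarrow> real^'n \<Rightarrow> complex" where
  "char_fun M X t = (CLINT \<omega>|M. iexp (t \<bullet> X \<omega>))"

text \<open>Only the values of \<open>\<phi>\<close> on \<open>[0,\<infinity>)\<close> matter when \<open>\<Sigma>\<close> is positive definite.\<close>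

definition elliptical ::
    "'a measure \<Rightarrow> ('a \<Rightarrow> real^'n) \<Rightarrow> real^'n \<Rightarrow> real^'n^'n \<Rightarrow> bool" where
  "elliptical M X \<mu> \<Sigma> \<longleftrightarrow>
     X \<in> borel_measurable M \<and> transpose \<Sigma> = \<Sigma> \<and>
     (\<exists>\<phi> :: real \<Rightarrow> real. \<forall>t. char_fun M X t = of_real (\<phi> (t \<bullet> (\<Sigma> *v t))) * iexp (\<mu> \<bullet> t))"

text \<open>
  Normalised surface measure on the unit sphere. The surface measure of a Borel set of directions is
  (a constant multiple of) the volume of the part of the unit ball lying in these directions, so the
  uniform distribution on the sphere is the image of the uniform distribution on the ball under
  \<open>sgn x = x / norm x\<close>. In dimension one this is the uniform distribution on \<open>{-1, 1}\<close>.
\<close>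

definition uniform_sphere :: "(real^'n) measure" where
  "uniform_sphere = distr (uniform_measure lborel (ball 0 1)) borel sgn"

lemma prob_space_uniform_sphere: "prob_space (uniform_sphere :: (real^'n) measure)"
proof -
  have "emeasure lborel (ball (0 :: real^'n) 1) \<noteq> 0"
    using content_ball_pos[of 1 "0 :: real^'n"] by (auto simp: measure_def)
  then have "prob_space (uniform_measure lborel (ball (0 :: real^'n) 1))"
    using emeasure_lborel_ball_finite[of "0 :: real^'n" 1]
    by (intro prob_space_uniform_measure) auto
  then show ?thesis
    unfolding uniform_sphere_def
    by (rule prob_space.prob_space_distr) (simp add: sgn_div_norm[abs_def])
qed

text \<open>
  The representation \<open>X = \<mu> + \<xi> \<Sigma>\<^sup>1\<^sup>/\<^sup>2 U\<close> is an equality in distribution: \<open>\<xi>\<close> and \<open>U\<close> may live on a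
  probability space of their own. The matrix \<open>S\<close> is the positive definite square root of \<open>\<Sigma>\<close>,
  which is unique. Independence is stated by \<open>indep_set\<close> for the generated sigma-algebras since
  \<open>indep_var\<close> requires both variables to have the same type.
\<close>

definition stochastic_representation ::
    "'a measure \<Rightarrow> ('a \<Rightarrow> real^'n) \<Rightarrow> real^'n \<Rightarrow> real^'n^'n \<Rightarrow>
     'b measure \<Rightarrow> ('b \<Rightarrow> real) \<Rightarrow> ('b \<Rightarrow> real^'n) \<Rightarrow> bool" where
  "stochastic_representation M X \<mu> \<Sigma> N \<xi> U \<longleftrightarrow>
     prob_space N \<and>
     \<xi> \<in> borel_measurable N \<and> U \<in> borel_measurable N \<and>
     prob_space.indep_set N {\<xi> -` A \<inter> space N | A. A \<in> sets borel}
                            {U -` B \<inter> space N | B. B \<in> sets borel} \<and>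
     (AE \<omega> in N. 0 \<le> \<xi> \<omega>) \<and>
     distr N borel U = uniform_sphere \<and>
     (\<exists>S. pos_def_matrix S \<and> S ** S = \<Sigma> \<and>
          distr M borel X = distr N borel (\<lambda>\<omega>. \<mu> + \<xi> \<omega> *\<^sub>R (S *v U \<omega>)))"

subsection \<open>Conditional correlation\<close>

text \<open>
  The sigma-algebra generated by the subvector \<open>X\<^sub>C\<close>; it is trivial for \<open>C = {}\<close>, so that
  conditioning on it is then no conditioning.
\<close>

definition sigma_subvector :: "'a measure \<Rightarrow> ('a \<Rightarrow> real^'n) \<Rightarrow> 'n set \<Rightarrow> 'a measure" where
  "sigma_subvector M X C =
     vimage_algebra (space M) (\<lambda>\<omega>. \<lambda>k\<in>C. X \<omega> $ k) (\<Pi>\<^sub>M k\<in>C. borel)"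

lemma subalgebra_sigma_subvector:
  assumes [measurable]: "X \<in> borel_measurable M"
  shows "subalgebra M (sigma_subvector M X C)"
proof -
  have "(\<lambda>\<omega>. \<lambda>k\<in>C. X \<omega> $ k) \<in> M \<rightarrow>\<^sub>M (\<Pi>\<^sub>M k\<in>C. borel)"
    by (intro measurable_restrict measurable_compose[OF assms borel_measurable_continuous_onI])
       (intro continuous_intros)
  then show ?thesis
    unfolding subalgebra_def sigma_subvector_def sets_vimage_algebra
    by (auto intro!: sets.sigma_sets_subset)
qed

definition cond_cov ::
    "'a measure \<Rightarrow> 'a measure \<Rightarrow> ('a \<Rightarrow> real) \<Rightarrow> ('a \<Rightarrow> real) \<Rightarrow> 'a \<Rightarrow> real" where
  "cond_cov M F Y Z =
     real_cond_exp M F (\<lambda>\<omega>. (Y \<omega> - real_cond_exp M F Y \<omega>) * (Z \<omega> - real_cond_exp M F Z \<omega>))"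

definition cond_corr ::
    "'a measure \<Rightarrow> 'a measure \<Rightarrow> ('a \<Rightarrow> real) \<Rightarrow> ('a \<Rightarrow> real) \<Rightarrow> 'a \<Rightarrow> real" where
  "cond_corr M F Y Z \<omega> =
     cond_cov M F Y Z \<omega> / sqrt (cond_cov M F Y Y \<omega> * cond_cov M F Z Z \<omega>)"

text \<open>
  The conditional correlation exists at \<open>\<omega>\<close> if both conditional second moments are finite there and
  both conditional variances are nonzero. The second moments are taken in \<open>ennreal\<close> because
  \<open>real_cond_exp\<close> does not record infinite values.
\<close>

definition cond_corr_defined ::
    "'a measure \<Rightarrow> 'a measure \<Rightarrow> ('a \<Rightarrow> real) \<Rightarrow> ('a \<Rightarrow> real) \<Rightarrow> 'a \<Rightarrow> bool" where
  "cond_corr_defined M F Y Z \<omega> \<longleftrightarrow>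
     nn_cond_exp M F (\<lambda>\<omega>. ennreal ((Y \<omega>)\<^sup>2)) \<omega> < \<infinity> \<and>
     nn_cond_exp M F (\<lambda>\<omega>. ennreal ((Z \<omega>)\<^sup>2)) \<omega> < \<infinity> \<and>
     cond_cov M F Y Y \<omega> \<noteq> 0 \<and> cond_cov M F Z Z \<omega> \<noteq> 0"

end

theory Submission
  imports Defs
begin

text \<open>
  Fix \<open>i \<noteq> j\<close> and let \<open>D = C \<union> {i}\<close>. The proof splits \<open>X\<^sub>j\<close> into its linear regression on \<open>X\<^sub>D\<close> and
  a residual,
    \<open>X\<^sub>j = \<beta> X\<^sub>i + h(X\<^sub>C) + W\<close>, \<open>W = a \<bullet> (X - \<mu>)\<close>, where \<open>(\<Sigma> a)\<^sub>k = 0\<close> for \<open>k \<in> D\<close>,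
  and combines three facts.

  First, \<open>\<beta> \<ge> 0\<close>. The regression coefficients are obtained by solving a linear system whose matrix
  is a principal submatrix of \<open>K = \<Sigma>\<^sup>-\<^sup>1\<close>. It is again an M-matrix, so it has a nonnegative inverse
  (\<open>M_matrix_inverse_nonneg\<close>), and the remaining entries of \<open>K\<close> that occur are off the diagonal
  (\<open>regression_residual_exists\<close>).

  Second, \<open>E[W | X\<^sub>D] = 0\<close> (\<open>cond_exp_residual_eq_0\<close>). For a Gaussian vector this would be
  independence; for an elliptical one it is a symmetry. The reflection that changes the sign of \<open>W\<close>
  and preserves \<open>\<Sigma>\<close> fixes the coordinates in \<open>D\<close>. It preserves the law of \<open>X\<close>, because in the
  representation \<open>\<mu> + \<xi> S U\<close> it amounts to a Euclidean reflection of the uniform direction \<open>U\<close>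
  (\<open>distr_reflected_law\<close>). So no conditional distribution has to be computed.

  Third, an increasing function of a variable is nonnegatively correlated with that variable,
  conditionally on any sigma-algebra. As \<open>W\<close> drops out by the second fact, the conditional
  covariance of \<open>g(X\<^sub>i)\<close> and \<open>X\<^sub>j\<close> given \<open>X\<^sub>C\<close> is that of \<open>g(X\<^sub>i)\<close> and \<open>X\<^sub>i\<close>, multiplied by \<open>\<beta>\<close>, and is nonnegative
  (\<open>cond_cov_mono_nonneg\<close>). The case \<open>i = j\<close> is this third fact alone.
\<close>

section \<open>M-matrices and the sign of regression coefficients\<close>

lemma inner_matrix_vector_symmetric:
  fixes A :: "real^'n^'n"
  assumes "transpose A = A"
  shows "x \<bullet> (A *v y) = (A *v x) \<bullet> y"
  by (metis assms dot_lmul_matrix transpose_matrix_vector)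

lemma pos_def_matrix_inverse:
  fixes K :: "real^'n^'n"
  assumes "pos_def_matrix K"
  shows "K ** matrix_inv K = mat 1" "matrix_inv K ** K = mat 1"
proof -
  have "\<forall>x. K *v x = 0 \<longrightarrow> x = 0"
    using assms by (metis inner_zero_right less_irrefl pos_def_matrix_def)
  then have "invertible K"
    using invertible_left_inverse matrix_left_invertible_ker by blast
  then have "\<exists>B. K ** B = mat 1 \<and> B ** K = mat 1"
    by (simp add: invertible_def)
  then have "K ** matrix_inv K = mat 1 \<and> matrix_inv K ** K = mat 1"
    unfolding matrix_inv_def by (rule someI_ex)
  then show "K ** matrix_inv K = mat 1" "matrix_inv K ** K = mat 1" by auto
qed

text \<open>
  If \<open>c\<close> and \<open>p\<close> are the negative and positive parts of \<open>b\<close>, their supports are disjoint, so only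
  off-diagonal entries of \<open>K\<close> enter \<open>c \<bullet> K p\<close> and this number is at most \<open>0\<close>. Together with
  \<open>c \<bullet> K b \<ge> 0\<close> it follows that \<open>c \<bullet> K c \<le> 0\<close>, which forces \<open>c = 0\<close>.
\<close>

lemma M_matrix_inverse_nonneg:
  fixes K :: "real^'n^'n"
  assumes K: "M_matrix K" and Kb: "\<And>k. 0 \<le> (K *v b) $ k"
  shows "0 \<le> b $ k"
proof -
  define c p :: "real^'n" where "c = (\<chi> k. max 0 (- b $ k))" and "p = (\<chi> k. max 0 (b $ k))"
  have "b = p - c"
    by (auto simp: vec_eq_iff c_def p_def max_def)
  then have "K *v c = K *v p - K *v b"
    by (simp add: matrix_vector_mult_diff_distrib)
  then have "c \<bullet> (K *v c) = c \<bullet> (K *v p) - c \<bullet> (K *v b)"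
    by (simp add: inner_diff_right)
  moreover have "0 \<le> c \<bullet> (K *v b)"
    unfolding inner_vec_def using Kb by (intro sum_nonneg) (auto simp: c_def)
  moreover have "c \<bullet> (K *v p) \<le> 0"
  proof -
    have "c $ k * (K $ k $ l * p $ l) \<le> 0" for k l
    proof (cases "k = l")
      case True
      then show ?thesis by (auto simp: c_def p_def max_def)
    next
      case False
      then have "K $ k $ l \<le> 0" "0 \<le> c $ k" "0 \<le> p $ l"
        using K by (auto simp: M_matrix_def c_def p_def)
      then show ?thesis
        by (simp add: mult_nonneg_nonpos mult_nonneg_nonpos2)
    qed
    then show ?thesis
      unfolding inner_vec_def matrix_vector_mult_def
      by (auto simp: sum_distrib_left intro!: sum_nonpos)
  qed
  ultimately have "\<not> 0 < c \<bullet> (K *v c)" by linarith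
  then have "c = 0"
    using K unfolding M_matrix_def pos_def_matrix_def by blast
  then have "c $ k = 0" by simp
  then show ?thesis by (simp add: c_def max_def split: if_splits)
qed

text \<open>
  If \<open>K\<close> is the inverse covariance matrix of a Gaussian vector, its block off \<open>D\<close> is the one of the
  coordinates off \<open>D\<close> conditionally on those in \<open>D\<close>. Completing the block by the identity on \<open>D\<close>
  keeps the index type fixed, where passing to a principal submatrix would change it.
\<close>

definition decouple :: "'n set \<Rightarrow> real^'n^'n \<Rightarrow> real^'n^'n" where
  "decouple D K = (\<chi> k l. if k \<notin> D \<and> l \<notin> D then K $ k $ l else if k = l then 1 else 0)"

lemma decouple_mult_vec:
  "decouple D K *v x = (\<chi> k. if k \<in> D then x $ k else (K *v (\<chi> l. if l \<in> D then 0 else x $ l)) $ k)"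
proof -
  have "(\<Sum>l\<in>UNIV. decouple D K $ k $ l * x $ l) =
        (if k \<in> D then x $ k else (\<Sum>l\<in>UNIV. K $ k $ l * (if l \<in> D then 0 else x $ l)))" for k
  proof (cases "k \<in> D")
    case True
    then have "(\<Sum>l\<in>UNIV. decouple D K $ k $ l * x $ l) = (\<Sum>l\<in>UNIV. if k = l then x $ l else 0)"
      by (intro sum.cong) (auto simp: decouple_def)
    then show ?thesis using True by simp
  next
    case False
    then show ?thesis
      by (auto simp: decouple_def intro!: sum.cong)
  qed
  then show ?thesis
    by (simp add: vec_eq_iff matrix_vector_mult_def)
qed

lemma M_matrix_decouple:
  assumes K: "M_matrix K"
  shows "M_matrix (decouple D K)"
proof -
  have sym: "K $ k $ l = K $ l $ k" for k l
  proof -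
    have "transpose K $ k $ l = K $ l $ k" by (simp add: transpose_def)
    then show ?thesis using K by (simp add: M_matrix_def pos_def_matrix_def)
  qed
  have "0 < x \<bullet> (decouple D K *v x)" if "x \<noteq> 0" for x
  proof -
    define y where "y = (\<chi> l. if l \<in> D then 0 else x $ l)"
    have quad: "x \<bullet> (decouple D K *v x) = (\<Sum>k\<in>D. x $ k * x $ k) + y \<bullet> (K *v y)"
    proof -
      have "x \<bullet> (decouple D K *v x) =
          (\<Sum>k\<in>UNIV. (if k \<in> D then x $ k * x $ k else 0) + y $ k * (K *v y) $ k)"
        unfolding inner_vec_def decouple_mult_vec y_def[symmetric]
        by (intro sum.cong) (auto simp: y_def)
      then show ?thesis
        by (simp add: sum.distrib inner_vec_def sum.If_cases)
    qed
    have D0: "0 \<le> (\<Sum>k\<in>D. x $ k * x $ k)" by (intro sum_nonneg) auto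
    show ?thesis
    proof (cases "y = 0")
      case False
      then have "0 < y \<bullet> (K *v y)" using K by (auto simp: M_matrix_def pos_def_matrix_def)
      then show ?thesis using quad D0 by linarith
    next
      case True
      then have off: "x $ k = 0" if "k \<notin> D" for k
        using that by (auto simp: y_def vec_eq_iff split: if_splits)
      obtain k where k: "x $ k \<noteq> 0" using \<open>x \<noteq> 0\<close> by (auto simp: vec_eq_iff)
      then have "k \<in> D" using off by auto
      have "0 < (\<Sum>k\<in>D. x $ k * x $ k)"
        by (rule sum_pos2[OF _ \<open>k \<in> D\<close>]) (use k in \<open>auto simp: zero_less_mult_iff\<close>)
      then show ?thesis using quad True by simp
    qed
  qed
  then show ?thesis
    using K sym by (auto simp: M_matrix_def pos_def_matrix_def decouple_def transpose_def vec_eq_iff)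
qed

text \<open>
  The vector \<open>a\<close> gives the residual \<open>a \<bullet> x = x\<^sub>j - (\<Sum>k\<in>D. \<beta>\<^sub>k x\<^sub>k)\<close> of the linear regression of
  \<open>x\<^sub>j\<close> on \<open>x\<^sub>D\<close>, whose coefficients are \<open>\<beta>\<^sub>k = - a\<^sub>k\<close>. It is \<open>a = K b\<close> for the vector \<open>b\<close> which
  vanishes on \<open>D\<close> and solves \<open>(K b)\<^sub>k = (e\<^sub>j)\<^sub>k\<close> off \<open>D\<close>. The vector \<open>b\<close> is nonnegative because
  the matrix of this system is an M-matrix. For \<open>k \<in> D\<close> the sum \<open>(K b)\<^sub>k\<close> involves only entries
  off the diagonal of \<open>K\<close>, which are nonpositive: this is where the regression coefficients become
  nonnegative.
\<close>

lemma regression_residual_exists: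
  fixes K :: "real^'n^'n"
  assumes K: "M_matrix K" and j: "j \<notin> D"
  obtains a where "a $ j = 1" "\<And>k. k \<notin> insert j D \<Longrightarrow> a $ k = 0" "\<And>k. k \<in> D \<Longrightarrow> a $ k \<le> 0"
    "\<And>k. k \<in> D \<Longrightarrow> (matrix_inv K *v a) $ k = 0"
proof -
  \<comment> \<open>In the construction, \<open>?L b = e\<^sub>j\<close> states both conditions on \<open>b\<close> at once, as \<open>e\<^sub>j\<close> vanishes on \<open>D\<close>.\<close>
  let ?L = "decouple D K"
  note L = M_matrix_decouple[OF K, of D]
  define b where "b = matrix_inv ?L *v axis j 1"
  define a where "a = K *v b"
  have Lb: "?L *v b = axis j 1"
    using pos_def_matrix_inverse(1)[of ?L] L
    by (simp add: b_def matrix_vector_mul_assoc M_matrix_def)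
  have b_nonneg: "0 \<le> b $ k" for k
    using M_matrix_inverse_nonneg[OF L, of b k] by (simp add: Lb axis_def)
  have b_D: "b $ k = 0" if "k \<in> D" for k
  proof -
    have "(?L *v b) $ k = b $ k" using that by (simp add: decouple_mult_vec)
    moreover have "k \<noteq> j" using that j by auto
    ultimately show ?thesis by (simp add: Lb axis_def)
  qed
  then have "(\<chi> l. if l \<in> D then 0 else b $ l) = b" by (simp add: vec_eq_iff)
  then have a_off: "a $ k = axis j 1 $ k" if "k \<notin> D" for k
    using that Lb[symmetric] by (simp add: a_def decouple_mult_vec)
  show ?thesis
  proof
    show "a $ j = 1" using a_off[OF j] by simp
    show "a $ k = 0" if "k \<notin> insert j D" for k using a_off[of k] that by (simp add: axis_def)
    show "a $ k \<le> 0" if "k \<in> D" for k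
    proof -
      have "K $ k $ l * b $ l \<le> 0" for l
      proof (cases "l = k")
        case True
        then show ?thesis using b_D that by simp
      next
        case False
        then show ?thesis using K b_nonneg[of l]
          by (auto simp: M_matrix_def intro!: mult_nonpos_nonneg)
      qed
      then show ?thesis by (simp add: a_def matrix_vector_mult_def sum_nonpos)
    qed
    have "matrix_inv K *v a = b"
      using pos_def_matrix_inverse(2)[of K] K
      by (simp add: a_def matrix_vector_mul_assoc M_matrix_def)
    then show "(matrix_inv K *v a) $ k = 0" if "k \<in> D" for k using b_D that by simp
  qed
qed

section \<open>Conditional covariance with an increasing function\<close>

lemma (in prob_space) sigma_finite_subalgebraI:
  assumes "subalgebra M F"
  shows "sigma_finite_subalgebra M F"
  using assms finite_measure_axioms finite_measure_subalgebra.intro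
    finite_measure_subalgebra_axioms.intro finite_measure_subalgebra_is_sigma_finite by blast

text \<open>
  Conditional expectations are local. This holds without integrability, since both the positive and
  the negative part are conditioned in the extended nonnegative reals; it therefore also applies to
  functions that are integrable on \<open>A\<close> only.
\<close>

lemma (in sigma_finite_subalgebra) real_cond_exp_indicator:
  assumes A: "A \<in> sets F" and [measurable]: "P \<in> borel_measurable M"
  shows "AE x in M. x \<in> A \<longrightarrow>
    real_cond_exp M F (\<lambda>x. indicator A x * P x) x = real_cond_exp M F P x"
proof -
  have [measurable]: "A \<in> sets M" using A subalg by (auto simp: subalgebra_def)
  have *: "AE x in M. indicator A x * nn_cond_exp M F (\<lambda>x. ennreal (Q x)) x =
      nn_cond_exp M F (\<lambda>x. indicator A x * ennreal (Q x)) x"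
    if [measurable]: "Q \<in> borel_measurable M" for Q
    using A by (intro nn_cond_exp_prod) auto
  have eq: "indicator A x * ennreal r = ennreal (indicator A x * r)" for r and x :: 'a
    by (simp split: split_indicator)
  show ?thesis
    using *[of P, unfolded eq, OF assms(2)] *[of "\<lambda>x. - P x", unfolded eq, OF borel_measurable_uminus[OF assms(2)]]
    by eventually_elim (auto simp: real_cond_exp_def)
qed

lemma square_integrable_mult:
  fixes f g :: "'a \<Rightarrow> real"
  assumes [measurable]: "f \<in> borel_measurable M" "g \<in> borel_measurable M"
    and "integrable M (\<lambda>x. (f x)\<^sup>2)" "integrable M (\<lambda>x. (g x)\<^sup>2)"
  shows "integrable M (\<lambda>x. f x * g x)"
proof (rule Bochner_Integration.integrable_bound[OF Bochner_Integration.integrable_add[OF assms(3,4)]])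
  have "\<bar>a * b\<bar> \<le> a\<^sup>2 + b\<^sup>2" for a b :: real
  proof -
    have "0 \<le> (\<bar>a\<bar> - \<bar>b\<bar>)\<^sup>2" "0 \<le> a\<^sup>2" "0 \<le> b\<^sup>2" by simp_all
    moreover have "(\<bar>a\<bar> - \<bar>b\<bar>)\<^sup>2 = a\<^sup>2 + b\<^sup>2 - 2 * \<bar>a * b\<bar>"
      by (simp add: power2_diff abs_mult)
    ultimately show ?thesis by linarith
  qed
  then show "AE x in M. norm (f x * g x) \<le> norm ((f x)\<^sup>2 + (g x)\<^sup>2)"
    by (intro AE_I2) (simp add: order_trans)
qed simp

text \<open>
  Write \<open>Y = g V\<close> and \<open>m\<^sub>V = E[V | F]\<close>, and similarly for \<open>Y\<close> and \<open>Z\<close>. As \<open>E[W | F] = 0\<close>,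
  one has \<open>Z - m\<^sub>Z = \<beta> (V - m\<^sub>V) + W\<close>. The part of the covariance coming from \<open>W\<close> vanishes
  after conditioning on \<open>G\<close>, for which \<open>Y - m\<^sub>Y\<close> is measurable. In the rest, \<open>m\<^sub>Y\<close> may be
  replaced by the \<open>F\<close>-measurable function \<open>g m\<^sub>V\<close>, because \<open>E[V - m\<^sub>V | F] = 0\<close>, and
  \<open>(g V - g m\<^sub>V) (V - m\<^sub>V) \<ge> 0\<close> by monotonicity.

  These products need not be integrable, since \<open>g V\<close> may have a finite conditional second moment
  only on part of the space. The computation is carried out on sets \<open>A n \<in> F\<close> that exhaust this part.
\<close>

lemma (in prob_space) cond_cov_mono_nonneg:
  fixes V W H Z :: "'a \<Rightarrow> real" and g :: "real \<Rightarrow> real"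
  assumes G: "subalgebra M G" and F: "subalgebra G F"
    and V_G: "V \<in> borel_measurable G" and V2: "integrable M (\<lambda>x. (V x)\<^sup>2)"
    and W_meas: "W \<in> borel_measurable M" and W2: "integrable M (\<lambda>x. (W x)\<^sup>2)"
    and W0: "AE x in M. real_cond_exp M G W x = 0"
    and H_F: "H \<in> borel_measurable F" and H_int: "integrable M H"
    and Z_eq: "\<And>x. x \<in> space M \<Longrightarrow> Z x = \<beta> * V x + W x + H x"
    and Z_meas: "Z \<in> borel_measurable M"
    and g: "mono g" and \<beta>: "0 \<le> \<beta>"
  shows "AE x in M. nn_cond_exp M F (\<lambda>x. ennreal ((g (V x))\<^sup>2)) x < \<infinity> \<longrightarrow>
    0 \<le> cond_cov M F (\<lambda>x. g (V x)) Z x"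
proof -
  have MF: "subalgebra M F" using G F by (auto simp: subalgebra_def)
  interpret G: sigma_finite_subalgebra M G
    by (rule sigma_finite_subalgebraI[OF G])
  interpret F: sigma_finite_subalgebra M F
    by (rule sigma_finite_subalgebraI[OF MF])
  have [measurable]: "g \<in> borel_measurable borel" by (rule borel_measurable_mono[OF g])
  have F_M: "f \<in> borel_measurable M" if "f \<in> borel_measurable F" for f :: "'a \<Rightarrow> real"
    by (rule measurable_from_subalg[OF MF that])
  have F_G: "f \<in> borel_measurable G" if "f \<in> borel_measurable F" for f :: "'a \<Rightarrow> real"
    by (rule measurable_from_subalg[OF F that])
  have [measurable]: "V \<in> borel_measurable M" by (rule measurable_from_subalg[OF G V_G])
  note W_meas[measurable] Z_meas[measurable]
  have V_int: "integrable M V" and W_int: "integrable M W"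
    by (rule square_integrable_imp_integrable; use V2 W2 in simp)+
  define Y where "Y = (\<lambda>x. g (V x))"
  have Y_G[measurable]: "Y \<in> borel_measurable G" unfolding Y_def using V_G by measurable
  have [measurable]: "Y \<in> borel_measurable M" by (rule measurable_from_subalg[OF G Y_G])
  define mY mZ mV where "mY = real_cond_exp M F Y" and "mZ = real_cond_exp M F Z"
    and "mV = real_cond_exp M F V"
  have m_F[measurable]: "mY \<in> borel_measurable F" "mZ \<in> borel_measurable F" "mV \<in> borel_measurable F"
    unfolding mY_def mZ_def mV_def by (rule borel_measurable_cond_exp)+
  have m_M[measurable]: "mY \<in> borel_measurable M" "mZ \<in> borel_measurable M" "mV \<in> borel_measurable M"
    unfolding mY_def mZ_def mV_def by (rule borel_measurable_cond_exp2)+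
  have m_G[measurable]: "mY \<in> borel_measurable G" by (intro F_G m_F)
  have gmV_F[measurable]: "(\<lambda>x. g (mV x)) \<in> borel_measurable F" by measurable

  have residual: "AE x in M. Z x - mZ x = \<beta> * (V x - mV x) + W x"
  proof -
    have "AE x in M. mZ x = real_cond_exp M F (\<lambda>x. (\<beta> * V x + W x) + H x) x"
      unfolding mZ_def by (rule F.real_cond_exp_cong) (use Z_eq F_M[OF H_F] in auto)
    moreover have "AE x in M. real_cond_exp M F (\<lambda>x. (\<beta> * V x + W x) + H x) x =
        real_cond_exp M F (\<lambda>x. \<beta> * V x + W x) x + real_cond_exp M F H x"
      using V_int W_int H_int by (intro F.real_cond_exp_add) auto
    moreover have "AE x in M. real_cond_exp M F (\<lambda>x. \<beta> * V x + W x) x =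
        real_cond_exp M F (\<lambda>x. \<beta> * V x) x + real_cond_exp M F W x"
      using V_int W_int by (intro F.real_cond_exp_add) auto
    moreover have "AE x in M. real_cond_exp M F (\<lambda>x. \<beta> * V x) x = \<beta> * mV x"
      unfolding mV_def using V_int by (rule F.real_cond_exp_cmult)
    moreover have "AE x in M. real_cond_exp M F H x = H x"
      by (rule F.real_cond_exp_F_meas[OF H_int H_F])
    moreover have "AE x in M. real_cond_exp M F W x = 0"
    proof -
      have "AE x in M. real_cond_exp M F (real_cond_exp M G W) x = real_cond_exp M F W x"
        by (rule F.real_cond_exp_nested_subalg[OF G F W_int])
      moreover have "AE x in M. real_cond_exp M F (real_cond_exp M G W) x =
          real_cond_exp M F (\<lambda>_. 0) x"
        by (rule F.real_cond_exp_cong[OF W0]) auto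
      moreover have "AE x in M. real_cond_exp M F (\<lambda>_. 0) x = 0"
        by (rule F.real_cond_exp_F_meas) auto
      ultimately show ?thesis by eventually_elim simp
    qed
    ultimately show ?thesis
      using AE_space by eventually_elim (simp add: Z_eq algebra_simps)
  qed

  let ?P = "\<lambda>x. (Y x - mY x) * (Z x - mZ x)"
  let ?N = "nn_cond_exp M F (\<lambda>x. ennreal ((Y x)\<^sup>2))"
  define A where
    "A n = {x \<in> space M. ?N x \<le> ennreal (real n) \<and> \<bar>mY x\<bar> \<le> real n \<and> \<bar>mV x\<bar> \<le> real n \<and> \<bar>g (mV x)\<bar> \<le> real n}"
    for n :: nat
  have spF: "space F = space M" using MF by (simp add: subalgebra_def)
  have A_F: "A n \<in> sets F" for n
    unfolding A_def spF[symmetric] using m_F gmV_F by measurable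
  have A_G: "A n \<in> sets G" for n using A_F F by (auto simp: subalgebra_def)
  have A_M[measurable]: "A n \<in> sets M" for n using A_G G by (auto simp: subalgebra_def)

  \<comment> \<open>On \<open>A n\<close> the functions \<open>mY\<close>, \<open>mV\<close> and \<open>g \<circ> mV\<close> are bounded and \<open>Y\<close> is square integrable.\<close>
  have on_A: "AE x in M. x \<in> A n \<longrightarrow> 0 \<le> real_cond_exp M F ?P x" for n
  proof -
    let ?I = "indicator (A n) :: 'a \<Rightarrow> real"
    have IF[measurable]: "?I \<in> borel_measurable F" using A_F by measurable
    have IG[measurable]: "?I \<in> borel_measurable G" using A_G by measurable
    have bdd_int2: "integrable M (\<lambda>x. (?I x * f x)\<^sup>2)"
      if [measurable]: "f \<in> borel_measurable M" and "\<And>x. x \<in> A n \<Longrightarrow> \<bar>f x\<bar> \<le> real n" for f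
    proof (rule integrable_const_bound[where B = "(real n)\<^sup>2"])
      show "AE x in M. norm ((?I x * f x)\<^sup>2) \<le> (real n)\<^sup>2"
      proof (intro AE_I2)
        fix x show "norm ((?I x * f x)\<^sup>2) \<le> (real n)\<^sup>2"
          using that(2)[of x] by (auto simp: abs_le_square_iff[symmetric] split: split_indicator)
      qed
    qed measurable
    have IY2: "integrable M (\<lambda>x. (?I x * Y x)\<^sup>2)"
    proof (rule integrableI_nonneg)
      have "(\<integral>\<^sup>+x. ennreal ((?I x * Y x)\<^sup>2) \<partial>M) = (\<integral>\<^sup>+x. indicator (A n) x * ennreal ((Y x)\<^sup>2) \<partial>M)"
        by (intro nn_integral_cong) (simp split: split_indicator)
      also have "\<dots> = (\<integral>\<^sup>+x. indicator (A n) x * ?N x \<partial>M)"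
        by (rule F.nn_cond_exp_intg[symmetric]) (use A_F in auto)
      also have "\<dots> \<le> (\<integral>\<^sup>+x. ennreal (real n) \<partial>M)"
        by (intro nn_integral_mono) (auto simp: A_def split: split_indicator)
      also have "\<dots> < \<infinity>" by (simp add: emeasure_space_1)
      finally show "(\<integral>\<^sup>+x. ennreal ((?I x * Y x)\<^sup>2) \<partial>M) < \<infinity>" .
    qed auto
    have ImY2: "integrable M (\<lambda>x. (?I x * mY x)\<^sup>2)" and ImV2: "integrable M (\<lambda>x. (?I x * mV x)\<^sup>2)"
      and IgmV2: "integrable M (\<lambda>x. (?I x * g (mV x))\<^sup>2)"
      by (rule bdd_int2; auto simp: A_def)+
    have IW: "integrable M (\<lambda>x. (?I x * (Y x - mY x)) * W x)"
    proof -
      have "integrable M (\<lambda>x. (?I x * Y x) * W x - (?I x * mY x) * W x)"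
        by (intro Bochner_Integration.integrable_diff square_integrable_mult IY2 ImY2 W2) measurable
      then show ?thesis by (simp add: algebra_simps)
    qed
    have IgV: "integrable M (\<lambda>x. ?I x * (Y x - g (mV x)) * (V x - mV x))"
    proof -
      have "integrable M (\<lambda>x. ((?I x * Y x) * V x - (?I x * Y x) * (?I x * mV x))
          - ((?I x * g (mV x)) * V x - (?I x * g (mV x)) * (?I x * mV x)))"
        by (intro Bochner_Integration.integrable_diff square_integrable_mult IY2 ImV2 IgmV2 V2) measurable
      then show ?thesis
        by (rule Bochner_Integration.integrable_cong[THEN iffD1, rotated 2])
           (auto simp: algebra_simps split: split_indicator)
    qed
    have IcV: "integrable M (\<lambda>x. (?I x * (g (mV x) - mY x)) * (V x - mV x))"
    proof -
      have "integrable M (\<lambda>x. ((?I x * g (mV x)) * V x - (?I x * g (mV x)) * (?I x * mV x))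
          - ((?I x * mY x) * V x - (?I x * mY x) * (?I x * mV x)))"
        by (intro Bochner_Integration.integrable_diff square_integrable_mult ImY2 ImV2 IgmV2 V2) measurable
      then show ?thesis
        by (rule Bochner_Integration.integrable_cong[THEN iffD1, rotated 2])
           (auto simp: algebra_simps split: split_indicator)
    qed
    have ce_W: "AE x in M. real_cond_exp M F (\<lambda>x. (?I x * (Y x - mY x)) * W x) x = 0"
    proof -
      have "AE x in M. real_cond_exp M G (\<lambda>x. (?I x * (Y x - mY x)) * W x) x
          = (?I x * (Y x - mY x)) * real_cond_exp M G W x"
        using IW by (intro G.real_cond_exp_mult) auto
      with W0 have "AE x in M. real_cond_exp M G (\<lambda>x. (?I x * (Y x - mY x)) * W x) x = 0"
        by eventually_elim simp
      then have "AE x in M. real_cond_exp M F (real_cond_exp M G (\<lambda>x. (?I x * (Y x - mY x)) * W x)) x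
          = real_cond_exp M F (\<lambda>_. 0) x"
        by (rule F.real_cond_exp_cong) auto
      moreover have "AE x in M. real_cond_exp M F (\<lambda>_. 0) x = 0"
        by (rule F.real_cond_exp_F_meas) auto
      moreover have "AE x in M. real_cond_exp M F (real_cond_exp M G (\<lambda>x. (?I x * (Y x - mY x)) * W x)) x
          = real_cond_exp M F (\<lambda>x. (?I x * (Y x - mY x)) * W x) x"
        by (rule F.real_cond_exp_nested_subalg[OF G F IW])
      ultimately show ?thesis by eventually_elim simp
    qed
    have ce_c: "AE x in M. real_cond_exp M F (\<lambda>x. (?I x * (g (mV x) - mY x)) * (V x - mV x)) x = 0"
    proof -
      have mV_int: "integrable M mV" unfolding mV_def using V_int by (rule F.real_cond_exp_int(1))
      have "AE x in M. real_cond_exp M F (\<lambda>x. (?I x * (g (mV x) - mY x)) * (V x - mV x)) x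
          = (?I x * (g (mV x) - mY x)) * real_cond_exp M F (\<lambda>x. V x - mV x) x"
        using IcV by (intro F.real_cond_exp_mult) auto
      moreover have "AE x in M. real_cond_exp M F (\<lambda>x. V x - mV x) x = mV x - real_cond_exp M F mV x"
        unfolding mV_def[symmetric] using F.real_cond_exp_diff[OF V_int mV_int]
        by (simp add: mV_def[symmetric])
      moreover have "AE x in M. real_cond_exp M F mV x = mV x"
        by (rule F.real_cond_exp_F_meas[OF mV_int]) auto
      ultimately show ?thesis by eventually_elim simp
    qed
    have ce_g: "AE x in M. 0 \<le> real_cond_exp M F (\<lambda>x. ?I x * (Y x - g (mV x)) * (V x - mV x)) x"
    proof (rule F.real_cond_exp_pos)
      have "0 \<le> (Y x - g (mV x)) * (V x - mV x)" for x
      proof (cases "mV x \<le> V x")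
        case True
        then show ?thesis using monoD[OF g True] by (simp add: Y_def)
      next
        case False
        then show ?thesis using monoD[OF g, of "V x" "mV x"]
          by (intro mult_nonpos_nonpos) (auto simp: Y_def)
      qed
      then show "AE x in M. 0 \<le> ?I x * (Y x - g (mV x)) * (V x - mV x)"
        by (intro AE_I2) (simp add: mult.assoc split: split_indicator)
    qed measurable
    \<comment> \<open>The three summands: the nonnegative one, the correction of the centre, and the residual.\<close>
    let ?a = "\<lambda>x. ?I x * (Y x - g (mV x)) * (V x - mV x)"
    let ?b = "\<lambda>x. (?I x * (g (mV x) - mY x)) * (V x - mV x)"
    let ?c = "\<lambda>x. (?I x * (Y x - mY x)) * W x"
    have "AE x in M. ?I x * ?P x = \<beta> * (?a x + ?b x) + ?c x"
      using residual
    proof eventually_elim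
      case (elim x)
      show ?case unfolding elim by (simp add: algebra_simps)
    qed
    then have "AE x in M. real_cond_exp M F (\<lambda>x. ?I x * ?P x) x =
        real_cond_exp M F (\<lambda>x. \<beta> * (?a x + ?b x) + ?c x) x"
      by (rule F.real_cond_exp_cong) measurable
    moreover have "AE x in M. real_cond_exp M F (\<lambda>x. \<beta> * (?a x + ?b x) + ?c x) x
        = real_cond_exp M F (\<lambda>x. \<beta> * (?a x + ?b x)) x + real_cond_exp M F ?c x"
      using IgV IcV IW by (intro F.real_cond_exp_add) auto
    moreover have "AE x in M. real_cond_exp M F (\<lambda>x. \<beta> * (?a x + ?b x)) x
        = \<beta> * real_cond_exp M F (\<lambda>x. ?a x + ?b x) x"
      using IgV IcV by (intro F.real_cond_exp_cmult) auto
    moreover have "AE x in M. real_cond_exp M F (\<lambda>x. ?a x + ?b x) x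
        = real_cond_exp M F ?a x + real_cond_exp M F ?b x"
      using IgV IcV by (intro F.real_cond_exp_add) auto
    moreover have "AE x in M. x \<in> A n \<longrightarrow>
        real_cond_exp M F (\<lambda>x. ?I x * ?P x) x = real_cond_exp M F ?P x"
      by (rule F.real_cond_exp_indicator[OF A_F]) measurable
    ultimately show ?thesis
      using ce_W ce_c ce_g
    proof eventually_elim
      case (elim x)
      have "0 \<le> real_cond_exp M F (\<lambda>x. ?I x * ?P x) x"
        unfolding elim using elim(7,8) \<beta> by simp
      then show ?case using elim(5) by auto
    qed
  qed
  have "AE x in M. \<forall>n. x \<in> A n \<longrightarrow> 0 \<le> real_cond_exp M F ?P x"
    unfolding AE_all_countable using on_A by blast
  then show ?thesis
    using AE_space
  proof eventually_elim
    case (elim x)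
    show ?case
    proof
      assume "nn_cond_exp M F (\<lambda>x. ennreal ((g (V x))\<^sup>2)) x < \<infinity>"
      then have fin: "?N x < \<infinity>" by (simp add: Y_def)
      obtain n :: nat where n: "max (max (enn2real (?N x)) \<bar>mY x\<bar>) (max \<bar>mV x\<bar> \<bar>g (mV x)\<bar>) \<le> real n"
        using real_arch_simple by blast
      have "?N x = ennreal (enn2real (?N x))" using fin by simp
      also have "\<dots> \<le> ennreal (real n)" using n by (intro ennreal_leI) simp
      finally have "x \<in> A n" using n elim(2) by (simp add: A_def)
      then have "0 \<le> real_cond_exp M F ?P x" using elim(1) by blast
      then show "0 \<le> cond_cov M F (\<lambda>x. g (V x)) Z x"
        by (simp add: cond_cov_def Y_def mY_def mZ_def)
    qed
  qed
qed

lemma cond_cov_self_nonneg: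
  assumes "prob_space M" and F: "subalgebra M F" and [measurable]: "Y \<in> borel_measurable M"
  shows "AE \<omega> in M. 0 \<le> cond_cov M F Y Y \<omega>"
proof -
  interpret prob_space M by fact
  interpret F: sigma_finite_subalgebra M F
    by (rule sigma_finite_subalgebraI[OF F])
  show ?thesis
    unfolding cond_cov_def by (rule F.real_cond_exp_pos) auto
qed

section \<open>Reflection symmetry of elliptical laws\<close>

definition reflection :: "'v::real_inner \<Rightarrow> 'v \<Rightarrow> 'v" where
  "reflection s u = u - (2 * (s \<bullet> u) / (s \<bullet> s)) *\<^sub>R s"

lemma orthogonal_transformation_reflection: "orthogonal_transformation (reflection s)"
  unfolding orthogonal_transformation_def
proof (intro conjI allI)
  show "linear (reflection s)"
    by (intro linearI)
      (auto simp: reflection_def algebra_simps inner_add_right add_divide_distrib)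
  show "reflection s u \<bullet> reflection s v = u \<bullet> v" for u v
    by (cases "s = 0") (auto simp: reflection_def algebra_simps inner_commute)
qed

text \<open>
  The double integral of \<open>1\<^sub>E(Q x) 1\<^sub>B(y - Q x)\<close>, for \<open>B\<close> the unit ball, is computed in two ways.
  Translating \<open>y\<close> by \<open>Q x\<close> gives the measure of \<open>B\<close> times that of \<open>Q -` E\<close>. Translating \<open>x\<close> by
  \<open>Q\<^sup>-\<^sup>1 y\<close> first turns the integrand into \<open>1\<^sub>E(y + Q x) 1\<^sub>B(- Q x)\<close>, where \<open>1\<^sub>B(- Q x) = 1\<^sub>B(x)\<close>, and
  gives the measure of \<open>B\<close> times that of \<open>E\<close>.
\<close>

lemma lborel_distr_orthogonal:
  fixes Q :: "'v::euclidean_space \<Rightarrow> 'v"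
  assumes Q: "orthogonal_transformation Q"
  shows "distr lborel borel Q = lborel"
proof (rule measure_eqI)
  have lin: "linear Q" using Q by (rule orthogonal_transformation_linear)
  have [measurable]: "Q \<in> borel_measurable borel"
    by (intro borel_measurable_continuous_onI linear_continuous_on linear_conv_bounded_linear[THEN iffD1] lin)
  have bij: "bij Q" using Q by (rule orthogonal_transformation_bij)
  fix E assume "E \<in> sets (distr lborel borel Q)"
  then have [measurable]: "E \<in> sets borel" by simp
  let ?B = "ball (0 :: 'v) 1"
  have shift: "(\<integral>\<^sup>+x. f (c + x) \<partial>lborel) = (\<integral>\<^sup>+x. f x \<partial>lborel)"
    if [measurable]: "f \<in> borel_measurable borel" for f :: "'v \<Rightarrow> ennreal" and c
  proof -
    have "(\<integral>\<^sup>+x. f x \<partial>lborel) = (\<integral>\<^sup>+x. f x \<partial>distr lborel borel ((+) c))"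
      by (simp only: lborel_distr_plus)
    also have "\<dots> = (\<integral>\<^sup>+x. f (c + x) \<partial>lborel)"
      by (subst nn_integral_distr) auto
    finally show ?thesis ..
  qed
  have B_meas[measurable]: "(indicator ?B :: 'v \<Rightarrow> ennreal) \<in> borel_measurable borel"
    by (rule borel_measurable_indicator) simp
  have ind_B: "indicator ?B (- Q x) = (indicator ?B x :: ennreal)" for x
    using Q by (auto simp: orthogonal_transformation_norm split: split_indicator)
  let ?f = "\<lambda>x y. indicator E (Q x) * indicator ?B (y - Q x) :: ennreal"
  have "emeasure lborel ?B * emeasure lborel (Q -` E) =
      emeasure lborel ?B * (\<integral>\<^sup>+x. indicator E (Q x) \<partial>lborel)"
    using measurable_sets[of Q borel borel E]
    by (simp add: indicator_vimage[symmetric] comp_def flip: nn_integral_indicator)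
  also have "\<dots> = (\<integral>\<^sup>+x. indicator E (Q x) * emeasure lborel ?B \<partial>lborel)"
    by (subst nn_integral_multc) (auto simp: mult.commute)
  also have "\<dots> = (\<integral>\<^sup>+x. indicator E (Q x) * (\<integral>\<^sup>+y. indicator ?B (- Q x + y) \<partial>lborel) \<partial>lborel)"
    by (simp only: shift[OF B_meas]) simp
  also have "\<dots> = (\<integral>\<^sup>+x. (\<integral>\<^sup>+y. ?f x y \<partial>lborel) \<partial>lborel)"
    by (subst nn_integral_cmult) auto
  also have "\<dots> = (\<integral>\<^sup>+y. (\<integral>\<^sup>+x. ?f x y \<partial>lborel) \<partial>lborel)"
    by (rule lborel_pair.Fubini') measurable
  also have "\<dots> = (\<integral>\<^sup>+y. (\<integral>\<^sup>+x. indicator E (y + Q x) * indicator ?B x \<partial>lborel) \<partial>lborel)"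
  proof (rule nn_integral_cong)
    fix y
    have "Q (inv Q y + x) = y + Q x" for x
      using bij by (simp add: linear_add[OF lin] bij_is_surj surj_f_inv_f)
    then have "?f (inv Q y + x) y = indicator E (y + Q x) * indicator ?B x" for x
      using ind_B[of x] by simp
    then show "(\<integral>\<^sup>+x. ?f x y \<partial>lborel) = (\<integral>\<^sup>+x. indicator E (y + Q x) * indicator ?B x \<partial>lborel)"
      using shift[of "\<lambda>x. ?f x y" "inv Q y"] by simp
  qed
  also have "\<dots> = (\<integral>\<^sup>+x. (\<integral>\<^sup>+y. indicator E (y + Q x) * indicator ?B x \<partial>lborel) \<partial>lborel)"
    by (rule lborel_pair.Fubini'[symmetric]) measurable
  also have "\<dots> = (\<integral>\<^sup>+x. (\<integral>\<^sup>+y. indicator E (Q x + y) \<partial>lborel) * indicator ?B x \<partial>lborel)"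
    by (subst nn_integral_multc) (auto simp: add.commute)
  also have "\<dots> = emeasure lborel E * emeasure lborel ?B"
    by (subst shift) (auto simp: nn_integral_cmult)
  finally have "emeasure lborel ?B * emeasure lborel (Q -` E) = emeasure lborel ?B * emeasure lborel E"
    by (simp add: mult.commute)
  moreover have "emeasure lborel ?B \<noteq> 0" "emeasure lborel ?B \<noteq> \<infinity>"
    using content_ball_pos[of 1 "0 :: 'v"] emeasure_lborel_ball_finite[of "0 :: 'v" 1]
    by (auto simp: measure_def)
  ultimately have "emeasure lborel (Q -` E) = emeasure lborel E"
    by (simp add: ennreal_mult_cancel_left)
  then show "emeasure (distr lborel borel Q) E = emeasure lborel E"
    by (simp add: emeasure_distr)
qed simp

text \<open>
  Lebesgue measure on the ball is invariant under orthogonal maps, and these commute with radial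
  projection.
\<close>

lemma distr_uniform_sphere_orthogonal:
  fixes Q :: "real^'n \<Rightarrow> real^'n"
  assumes Q: "orthogonal_transformation Q"
  shows "distr uniform_sphere borel Q = uniform_sphere"
proof -
  let ?u = "uniform_measure lborel (ball (0 :: real^'n) 1)"
  have lin: "linear Q" using Q by (rule orthogonal_transformation_linear)
  have [measurable]: "Q \<in> borel_measurable borel"
    by (intro borel_measurable_continuous_onI linear_continuous_on linear_conv_bounded_linear[THEN iffD1] lin)
  have [measurable]: "sgn \<in> borel_measurable (borel :: (real^'n) measure)"
    by (simp add: sgn_div_norm[abs_def])
  have "distr ?u borel Q = ?u"
  proof (rule measure_eqI)
    fix B assume "B \<in> sets (distr ?u borel Q)"
    then have B[measurable]: "B \<in> sets borel" by simp
    have vB[measurable]: "Q -` B \<in> sets borel"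
      using measurable_sets[of Q borel borel B] by simp
    have "ball 0 1 \<inter> Q -` B = Q -` (ball 0 1 \<inter> B)"
      using Q by (auto simp: orthogonal_transformation_norm)
    also have "emeasure lborel \<dots> = emeasure (distr lborel borel Q) (ball 0 1 \<inter> B)"
      by (simp add: emeasure_distr)
    also have "\<dots> = emeasure lborel (ball 0 1 \<inter> B)"
      by (simp only: lborel_distr_orthogonal[OF Q])
    finally have "emeasure lborel (ball 0 1 \<inter> Q -` B) = emeasure lborel (ball 0 1 \<inter> B)" .
    then show "emeasure (distr ?u borel Q) B = emeasure ?u B"
      by (simp add: emeasure_distr)
  qed simp
  moreover have "Q (sgn x) = sgn (Q x)" for x
    using Q lin by (simp add: sgn_div_norm orthogonal_transformation_norm linear_cmul)
  then have "distr uniform_sphere borel Q = distr (distr ?u borel Q) borel sgn"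
    unfolding uniform_sphere_def by (simp add: distr_distr comp_def)
  ultimately show ?thesis by (simp add: uniform_sphere_def)
qed

lemma (in prob_space) distr_pair_of_indep_events:
  assumes X[measurable]: "X \<in> measurable M S" and Y[measurable]: "Y \<in> measurable M T"
    and indep: "\<And>A B. A \<in> sets S \<Longrightarrow> B \<in> sets T \<Longrightarrow>
      prob ((X -` A \<inter> space M) \<inter> (Y -` B \<inter> space M)) = prob (X -` A \<inter> space M) * prob (Y -` B \<inter> space M)"
  shows "distr M (S \<Otimes>\<^sub>M T) (\<lambda>\<omega>. (X \<omega>, Y \<omega>)) = distr M S X \<Otimes>\<^sub>M distr M T Y"
proof (rule pair_measure_eqI[symmetric])
  interpret X: prob_space "distr M S X" by (rule prob_space_distr) fact
  interpret Y: prob_space "distr M T Y" by (rule prob_space_distr) fact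
  show "sigma_finite_measure (distr M S X)" "sigma_finite_measure (distr M T Y)"
    by unfold_locales
  fix A B assume "A \<in> sets (distr M S X)" "B \<in> sets (distr M T Y)"
  then have [measurable]: "A \<in> sets S" "B \<in> sets T" by auto
  have "(\<lambda>\<omega>. (X \<omega>, Y \<omega>)) -` (A \<times> B) \<inter> space M = (X -` A \<inter> space M) \<inter> (Y -` B \<inter> space M)"
    by auto
  then show "emeasure (distr M S X) A * emeasure (distr M T Y) B =
      emeasure (distr M (S \<Otimes>\<^sub>M T) (\<lambda>\<omega>. (X \<omega>, Y \<omega>))) (A \<times> B)"
    using indep[of A B] by (simp add: emeasure_distr emeasure_eq_measure ennreal_mult)
qed (simp cong: sets_pair_measure_cong)

text \<open>
  The map is the reflection that is orthogonal for the inner product \<open>\<Sigma>\<^sup>-\<^sup>1\<close>, is centred at \<open>\<mu>\<close>, and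
  reverses the sign of \<open>a \<bullet> (x - \<mu>)\<close> (for \<open>a = 0\<close> it is the identity). Applied to \<open>\<mu> + \<xi> S U\<close>
  with \<open>S\<^sup>2 = \<Sigma>\<close>, it replaces \<open>U\<close> by its Euclidean reflection in the hyperplane orthogonal to \<open>S a\<close>. This does not change the joint
  law of \<open>\<xi>\<close> and \<open>U\<close>, as \<open>U\<close> is uniform on the sphere and independent of \<open>\<xi>\<close>.
\<close>

lemma distr_reflected_law:
  fixes X :: "'a \<Rightarrow> real^'n" and U :: "'b \<Rightarrow> real^'n"
  assumes X[measurable]: "X \<in> borel_measurable M"
    and rep: "stochastic_representation M X \<mu> \<Sigma> N \<xi> U"
  shows "distr M borel (\<lambda>\<omega>. X \<omega> - (2 * (a \<bullet> (X \<omega> - \<mu>)) / (a \<bullet> (\<Sigma> *v a))) *\<^sub>R (\<Sigma> *v a)) = distr M borel X"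
proof -
  interpret N: prob_space N using rep by (simp add: stochastic_representation_def)
  obtain S where S: "pos_def_matrix S" "S ** S = \<Sigma>"
    and law: "distr M borel X = distr N borel (\<lambda>\<omega>. \<mu> + \<xi> \<omega> *\<^sub>R (S *v U \<omega>))"
    using rep by (auto simp: stochastic_representation_def)
  have [measurable]: "\<xi> \<in> borel_measurable N" "U \<in> borel_measurable N"
    and unif: "distr N borel U = uniform_sphere"
    and indep: "N.indep_set {\<xi> -` A \<inter> space N | A. A \<in> sets borel} {U -` B \<inter> space N | B. B \<in> sets borel}"
    using rep by (auto simp: stochastic_representation_def)
  define s where "s = S *v a"
  let ?Q = "reflection s"
  let ?T = "\<lambda>x. x - (2 * (a \<bullet> (x - \<mu>)) / (a \<bullet> (\<Sigma> *v a))) *\<^sub>R (\<Sigma> *v a)"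
  let ?f = "\<lambda>(r, u). \<mu> + r *\<^sub>R (S *v u)"
  have Sm[measurable]: "(*v) S \<in> borel_measurable borel"
    by (intro borel_measurable_continuous_onI matrix_vector_mult_linear_continuous_on)
  have Qm[measurable]: "?Q \<in> borel_measurable borel"
    unfolding reflection_def by measurable
  have Tm[measurable]: "?T \<in> borel_measurable borel" by measurable
  have fm[measurable]: "?f \<in> borel_measurable (borel \<Otimes>\<^sub>M borel)" by measurable
  have S_sym: "x \<bullet> (S *v y) = (S *v x) \<bullet> y" for x y
    using S(1) inner_matrix_vector_symmetric by (auto simp: pos_def_matrix_def)
  have Sigma_a: "\<Sigma> *v a = S *v s"
    by (simp add: s_def S(2)[symmetric] matrix_vector_mul_assoc)
  have T_f: "?T (?f (r, u)) = ?f (r, ?Q u)" for r u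
  proof -
    have "a \<bullet> (\<Sigma> *v a) = s \<bullet> s" and "a \<bullet> (S *v u) = s \<bullet> u"
      by (simp_all add: Sigma_a S_sym s_def)
    then show ?thesis
      by (simp add: Sigma_a reflection_def matrix_vector_mult_diff_distrib
          matrix_vector_mult_scaleR algebra_simps)
  qed
  have U_indep: "measure N ((\<xi> -` A \<inter> space N) \<inter> (U -` B \<inter> space N)) =
      measure N (\<xi> -` A \<inter> space N) * measure N (U -` B \<inter> space N)"
    if "A \<in> sets borel" "B \<in> sets borel" for A B
    by (rule N.indep_setD[OF indep]) (use that in auto)
  have QU_indep: "measure N ((\<xi> -` A \<inter> space N) \<inter> ((\<lambda>\<omega>. ?Q (U \<omega>)) -` B \<inter> space N)) =
      measure N (\<xi> -` A \<inter> space N) * measure N ((\<lambda>\<omega>. ?Q (U \<omega>)) -` B \<inter> space N)"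
    if "A \<in> sets borel" "B \<in> sets borel" for A B
    using U_indep[OF that(1), of "?Q -` B"] measurable_sets[OF Qm, of B] that
    by (simp add: vimage_def)
  have "distr N borel (\<lambda>\<omega>. ?Q (U \<omega>)) = distr N borel U"
    using distr_uniform_sphere_orthogonal[OF orthogonal_transformation_reflection, of s]
    by (simp add: unif[symmetric] distr_distr comp_def)
  then have "distr N (borel \<Otimes>\<^sub>M borel) (\<lambda>\<omega>. (\<xi> \<omega>, ?Q (U \<omega>))) =
      distr N (borel \<Otimes>\<^sub>M borel) (\<lambda>\<omega>. (\<xi> \<omega>, U \<omega>))"
    using N.distr_pair_of_indep_events[OF _ _ U_indep] N.distr_pair_of_indep_events[OF _ _ QU_indep]
    by simp
  then have "distr N borel (\<lambda>\<omega>. ?f (\<xi> \<omega>, ?Q (U \<omega>))) = distr N borel (\<lambda>\<omega>. ?f (\<xi> \<omega>, U \<omega>))"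
    using distr_distr[OF fm, of "\<lambda>\<omega>. (\<xi> \<omega>, ?Q (U \<omega>))" N] distr_distr[OF fm, of "\<lambda>\<omega>. (\<xi> \<omega>, U \<omega>)" N]
    by (simp add: comp_def)
  moreover have "distr (distr M borel X) borel ?T = distr N borel (\<lambda>\<omega>. ?T (?f (\<xi> \<omega>, U \<omega>)))"
    unfolding law by (subst distr_distr) (auto simp: comp_def)
  ultimately have "distr (distr M borel X) borel ?T = distr M borel X"
    by (simp only: T_f law) simp
  then show ?thesis
    by (simp add: distr_distr comp_def)
qed

lemma square_integrable_norm:
  fixes X :: "'a \<Rightarrow> real^'n"
  assumes X[measurable]: "X \<in> borel_measurable M"
    and rep: "stochastic_representation M X \<mu> \<Sigma> N \<xi> U"
    and xi2: "integrable N (\<lambda>\<omega>. (\<xi> \<omega>)\<^sup>2)"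
  shows "integrable M (\<lambda>\<omega>. (norm (X \<omega>))\<^sup>2)"
proof -
  interpret N: prob_space N using rep by (simp add: stochastic_representation_def)
  obtain S where law: "distr M borel X = distr N borel (\<lambda>\<omega>. \<mu> + \<xi> \<omega> *\<^sub>R (S *v U \<omega>))"
    using rep by (auto simp: stochastic_representation_def)
  have [measurable]: "\<xi> \<in> borel_measurable N" "U \<in> borel_measurable N"
    and unif: "distr N borel U = uniform_sphere"
    using rep by (auto simp: stochastic_representation_def)
  have Sm[measurable]: "(*v) S \<in> borel_measurable borel"
    by (intro borel_measurable_continuous_onI matrix_vector_mult_linear_continuous_on)
  have [measurable]: "sgn \<in> borel_measurable (borel :: (real^'n) measure)"
    by (simp add: sgn_div_norm[abs_def])
  have "AE u in (uniform_sphere :: (real^'n) measure). norm u \<le> 1"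
    unfolding uniform_sphere_def by (subst AE_distr_iff) (auto simp: norm_sgn)
  then have U1: "AE \<omega> in N. norm (U \<omega>) \<le> 1"
    unfolding unif[symmetric] by (subst (asm) AE_distr_iff) auto
  obtain B where B: "\<And>u. norm (S *v u) \<le> norm u * B" "0 \<le> B"
    using bounded_linear.nonneg_bounded[OF matrix_vector_mul_bounded_linear[of S]] by blast
  have "integrable N (\<lambda>\<omega>. (norm (\<mu> + \<xi> \<omega> *\<^sub>R (S *v U \<omega>)))\<^sup>2)"
  proof (rule Bochner_Integration.integrable_bound)
    show "integrable N (\<lambda>\<omega>. 2 * (norm \<mu>)\<^sup>2 + 2 * B\<^sup>2 * (\<xi> \<omega>)\<^sup>2)"
      using xi2 by auto
    show "AE \<omega> in N. norm ((norm (\<mu> + \<xi> \<omega> *\<^sub>R (S *v U \<omega>)))\<^sup>2) \<le>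
        norm (2 * (norm \<mu>)\<^sup>2 + 2 * B\<^sup>2 * (\<xi> \<omega>)\<^sup>2)"
      using U1
    proof eventually_elim
      case (elim \<omega>)
      have "norm (S *v U \<omega>) \<le> 1 * B"
        using B(1)[of "U \<omega>"] mult_right_mono[OF elim B(2)] by linarith
      then have "\<bar>\<xi> \<omega>\<bar> * norm (S *v U \<omega>) \<le> \<bar>\<xi> \<omega>\<bar> * B"
        by (intro mult_left_mono) auto
      then have "norm (\<mu> + \<xi> \<omega> *\<^sub>R (S *v U \<omega>)) \<le> norm \<mu> + B * \<bar>\<xi> \<omega>\<bar>"
        using norm_triangle_ineq[of \<mu> "\<xi> \<omega> *\<^sub>R (S *v U \<omega>)"] by (simp add: mult.commute)
      then have "(norm (\<mu> + \<xi> \<omega> *\<^sub>R (S *v U \<omega>)))\<^sup>2 \<le> (norm \<mu> + B * \<bar>\<xi> \<omega>\<bar>)\<^sup>2"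
        by (intro power_mono) auto
      also have "\<dots> \<le> 2 * (norm \<mu>)\<^sup>2 + 2 * B\<^sup>2 * (\<xi> \<omega>)\<^sup>2"
        using zero_le_power2[of "norm \<mu> - B * \<bar>\<xi> \<omega>\<bar>"]
        by (simp add: power2_eq_square algebra_simps abs_mult_self_eq)
      finally show ?case by simp
    qed
  qed measurable
  then have "integrable (distr M borel X) (\<lambda>x. (norm x)\<^sup>2)"
    unfolding law by (subst integrable_distr_eq) auto
  then show ?thesis
    by (subst (asm) integrable_distr_eq) auto
qed

section \<open>Regression on a subvector\<close>

lemma component_measurable_sigma_subvector:
  assumes "k \<in> C"
  shows "(\<lambda>\<omega>. X \<omega> $ k) \<in> borel_measurable (sigma_subvector M X C)"
proof -
  have "(\<lambda>\<omega>. \<lambda>k\<in>C. X \<omega> $ k) \<in> sigma_subvector M X C \<rightarrow>\<^sub>M (\<Pi>\<^sub>M k\<in>C. borel)"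
    unfolding sigma_subvector_def by (rule measurable_vimage_algebra1) (auto simp: space_PiM)
  from measurable_compose[OF this measurable_component_singleton[OF assms]] assms
  show ?thesis by simp
qed

lemma subalgebra_sigma_subvector_mono:
  assumes "C \<subseteq> D"
  shows "subalgebra (sigma_subvector M X D) (sigma_subvector M X C)"
proof -
  have "sets (sigma_subvector M X C) \<subseteq> sets (sigma_subvector M X D)"
    unfolding sigma_subvector_def[of M X C]
  proof (rule sets_image_in_sets)
    show "(\<lambda>\<omega>. \<lambda>k\<in>C. X \<omega> $ k) \<in> sigma_subvector M X D \<rightarrow>\<^sub>M (\<Pi>\<^sub>M k\<in>C. borel)"
      using assms by (intro measurable_restrict component_measurable_sigma_subvector) auto
  qed (simp add: sigma_subvector_def)
  then show ?thesis by (simp add: subalgebra_def sigma_subvector_def)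
qed

text \<open>
  The reflection of \<open>distr_reflected_law\<close> moves points only along \<open>\<Sigma> a\<close>, hence fixes the
  coordinates in \<open>D\<close>, and it reverses the sign of the residual. So \<open>X\<^sub>D\<close> together with the
  residual has the same law as \<open>X\<^sub>D\<close> together with the negative of the residual.
\<close>

lemma cond_exp_residual_eq_0:
  fixes X :: "'a \<Rightarrow> real^'n"
  assumes "prob_space M" and X[measurable]: "X \<in> borel_measurable M"
    and rep: "stochastic_representation M X \<mu> \<Sigma> N \<xi> U"
    and int: "integrable M (\<lambda>\<omega>. a \<bullet> (X \<omega> - \<mu>))"
    and D: "\<And>k. k \<in> D \<Longrightarrow> (\<Sigma> *v a) $ k = 0"
    and nz: "a \<bullet> (\<Sigma> *v a) \<noteq> 0"
  shows "AE \<omega> in M. real_cond_exp M (sigma_subvector M X D) (\<lambda>\<omega>. a \<bullet> (X \<omega> - \<mu>)) \<omega> = 0"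
proof -
  interpret prob_space M by fact
  let ?G = "sigma_subvector M X D"
  have G: "subalgebra M ?G" using X by (rule subalgebra_sigma_subvector)
  interpret G: sigma_finite_subalgebra M ?G
    by (rule sigma_finite_subalgebraI[OF G])
  let ?T = "\<lambda>x. x - (2 * (a \<bullet> (x - \<mu>)) / (a \<bullet> (\<Sigma> *v a))) *\<^sub>R (\<Sigma> *v a)"
  let ?r = "\<lambda>x :: real^'n. \<lambda>k\<in>D. x $ k"
  show ?thesis
  proof (rule G.real_cond_exp_charact)
    fix A assume "A \<in> sets ?G"
    then obtain B where B[measurable]: "B \<in> sets (\<Pi>\<^sub>M k\<in>D. borel)"
      and A: "A = (\<lambda>\<omega>. ?r (X \<omega>)) -` B \<inter> space M"
      unfolding sigma_subvector_def by (auto simp: sets_vimage_algebra2 space_PiM)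
    have rm[measurable]: "?r \<in> borel \<rightarrow>\<^sub>M (\<Pi>\<^sub>M k\<in>D. borel)"
      by (intro measurable_restrict borel_measurable_continuous_onI continuous_intros)
    define h where "h = (\<lambda>x. indicator B (?r x) * (a \<bullet> (x - \<mu>)))"
    have h_meas[measurable]: "h \<in> borel_measurable borel"
      unfolding h_def by measurable
    have Tm[measurable]: "?T \<in> borel_measurable borel" by measurable
    have r_T: "?r (?T x) = ?r x" for x
      using D by (auto simp: fun_eq_iff restrict_def)
    have a_T: "a \<bullet> (?T x - \<mu>) = - (a \<bullet> (x - \<mu>))" for x
      using nz by (simp add: inner_diff_right)
    have h_T: "h (?T x) = - h x" for x
    proof -
      have "h (?T x) = indicator B (?r (?T x)) * (a \<bullet> (?T x - \<mu>))"
        by (simp only: h_def)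
      also have "\<dots> = - h x"
        unfolding r_T a_T h_def by simp
      finally show ?thesis .
    qed
    have "(\<integral>\<omega>. h (X \<omega>) \<partial>M) = (\<integral>x. h x \<partial>distr M borel X)"
      by (simp add: integral_distr)
    also have "\<dots> = (\<integral>x. h x \<partial>distr M borel (\<lambda>\<omega>. ?T (X \<omega>)))"
      by (simp only: distr_reflected_law[OF X rep])
    also have "\<dots> = (\<integral>\<omega>. h (?T (X \<omega>)) \<partial>M)"
      by (subst integral_distr) auto
    also have "\<dots> = - (\<integral>\<omega>. h (X \<omega>) \<partial>M)"
      by (simp only: h_T) simp
    finally have "(\<integral>\<omega>. h (X \<omega>) \<partial>M) = 0" by simp
    moreover have "(\<integral>\<omega>\<in>A. a \<bullet> (X \<omega> - \<mu>) \<partial>M) = (\<integral>\<omega>. h (X \<omega>) \<partial>M)"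
      unfolding set_lebesgue_integral_def
      by (intro Bochner_Integration.integral_cong) (auto simp: A h_def split: split_indicator)
    ultimately show "(\<integral>\<omega>\<in>A. a \<bullet> (X \<omega> - \<mu>) \<partial>M) = (\<integral>\<omega>\<in>A. 0 \<partial>M)"
      by (simp add: set_lebesgue_integral_def)
  qed (use int in auto)
qed

section \<open>Positive dependence under inverse M-matrices\<close>

theorem proposition4p13:
  fixes M :: "'a measure" and X :: "'a \<Rightarrow> real^'n"
    and N :: "'b measure" and \<xi> :: "'b \<Rightarrow> real" and U :: "'b \<Rightarrow> real^'n"
    and \<mu> :: "real^'n" and \<Sigma> K :: "real^'n^'n"
    and g :: "real \<Rightarrow> real" and i j :: 'n and C :: "'n set"
  assumes "prob_space M"
    and "elliptical M X \<mu> \<Sigma>"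
    and "pos_def_matrix \<Sigma>"
    and "stochastic_representation M X \<mu> \<Sigma> N \<xi> U"
    and "integrable N (\<lambda>\<omega>. (\<xi> \<omega>)\<^sup>2)"
    and "0 < integral\<^sup>L N (\<lambda>\<omega>. (\<xi> \<omega>)\<^sup>2)"
    and "M_matrix K" and "\<Sigma> = matrix_inv K"
    and "mono g"
    and "C \<subseteq> UNIV - {i, j}"
  shows "AE \<omega> in M.
           cond_corr_defined M (sigma_subvector M X C) (\<lambda>\<omega>. g (X \<omega> $ i)) (\<lambda>\<omega>. X \<omega> $ j) \<omega> \<longrightarrow>
           0 \<le> cond_corr M (sigma_subvector M X C) (\<lambda>\<omega>. g (X \<omega> $ i)) (\<lambda>\<omega>. X \<omega> $ j) \<omega>"
proof -
  interpret prob_space M by fact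
  have X[measurable]: "X \<in> borel_measurable M"
    using assms(2) by (simp add: elliptical_def)
  note rep = assms(4)
  let ?F = "sigma_subvector M X C" and ?D = "insert i C"
  let ?G = "sigma_subvector M X ?D"
  have [measurable]: "(\<lambda>x. x $ k) \<in> borel_measurable (borel :: (real^'n) measure)" for k
    by (intro borel_measurable_continuous_onI continuous_intros)
  have [measurable]: "g \<in> borel_measurable borel"
    by (rule borel_measurable_mono) fact
  have norm2: "integrable M (\<lambda>\<omega>. (norm (X \<omega>))\<^sup>2)"
    by (rule square_integrable_norm[OF X rep assms(5)])
  have X2: "integrable M (\<lambda>\<omega>. (X \<omega> $ k)\<^sup>2)" for k
    by (rule Bochner_Integration.integrable_bound[OF norm2])
      (auto simp: component_le_norm_cart abs_le_square_iff[symmetric])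
  have X1: "integrable M (\<lambda>\<omega>. X \<omega> $ k)" for k
    by (rule square_integrable_imp_integrable[OF _ X2]) measurable
  have G: "subalgebra M ?G" by (rule subalgebra_sigma_subvector[OF X])
  have F: "subalgebra ?G ?F" by (rule subalgebra_sigma_subvector_mono) auto
  have V: "(\<lambda>\<omega>. X \<omega> $ i) \<in> borel_measurable ?G"
    by (rule component_measurable_sigma_subvector) simp
  interpret G: sigma_finite_subalgebra M ?G
    by (rule sigma_finite_subalgebraI[OF G])

  have cov: "AE \<omega> in M. nn_cond_exp M ?F (\<lambda>\<omega>. ennreal ((g (X \<omega> $ i))\<^sup>2)) \<omega> < \<infinity> \<longrightarrow>
      0 \<le> cond_cov M ?F (\<lambda>\<omega>. g (X \<omega> $ i)) (\<lambda>\<omega>. X \<omega> $ j) \<omega>"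
  proof (cases "i = j")
    case True
    have "AE \<omega> in M. real_cond_exp M ?G (\<lambda>_. 0) \<omega> = 0"
      by (rule G.real_cond_exp_F_meas) auto
    then show ?thesis
      by (intro cond_cov_mono_nonneg[where W = "\<lambda>_. 0" and H = "\<lambda>_. 0" and \<beta> = 1, OF G F V X2])
        (use True \<open>mono g\<close> in auto)
  next
    case False
    then have "j \<notin> ?D" using assms(10) by auto
    then obtain a where a_j: "a $ j = 1" and a_off: "\<And>k. k \<notin> insert j ?D \<Longrightarrow> a $ k = 0"
      and a_D: "\<And>k. k \<in> ?D \<Longrightarrow> a $ k \<le> 0" and \<Sigma>a: "\<And>k. k \<in> ?D \<Longrightarrow> (\<Sigma> *v a) $ k = 0"
      using regression_residual_exists[OF assms(7), of j ?D] unfolding assms(8) by blast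
    let ?W = "\<lambda>\<omega>. a \<bullet> (X \<omega> - \<mu>)" and ?H = "\<lambda>\<omega>. a \<bullet> \<mu> - (\<Sum>k\<in>C. a $ k * X \<omega> $ k)"
    have "a \<noteq> 0" using a_j by auto
    then have nz: "a \<bullet> (\<Sigma> *v a) \<noteq> 0"
      using assms(3) by (auto simp: pos_def_matrix_def less_le)
    have W2: "integrable M (\<lambda>\<omega>. (?W \<omega>)\<^sup>2)"
    proof (rule Bochner_Integration.integrable_bound)
      show "integrable M (\<lambda>\<omega>. (norm a)\<^sup>2 * (2 * (norm (X \<omega>))\<^sup>2 + 2 * (norm \<mu>)\<^sup>2))"
        using norm2 by auto
      have "(a \<bullet> (x - \<mu>))\<^sup>2 \<le> (norm a)\<^sup>2 * (2 * (norm x)\<^sup>2 + 2 * (norm \<mu>)\<^sup>2)" for x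
      proof -
        have "(a \<bullet> (x - \<mu>))\<^sup>2 \<le> (norm a)\<^sup>2 * (norm (x - \<mu>))\<^sup>2"
          using Cauchy_Schwarz_ineq[of a "x - \<mu>"] by (simp add: power2_norm_eq_inner)
        also have "(norm (x - \<mu>))\<^sup>2 \<le> (norm x + norm \<mu>)\<^sup>2"
          by (intro power_mono norm_triangle_ineq4) auto
        also have "(norm x + norm \<mu>)\<^sup>2 \<le> 2 * (norm x)\<^sup>2 + 2 * (norm \<mu>)\<^sup>2"
          using zero_le_power2[of "norm x - norm \<mu>"] by (simp add: power2_eq_square algebra_simps)
        finally show ?thesis by (simp add: mult_left_mono)
      qed
      then show "AE \<omega> in M. norm ((?W \<omega>)\<^sup>2) \<le>
          norm ((norm a)\<^sup>2 * (2 * (norm (X \<omega>))\<^sup>2 + 2 * (norm \<mu>)\<^sup>2))"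
        by (intro AE_I2) simp
    qed measurable
    have W1: "integrable M ?W"
      by (rule square_integrable_imp_integrable[OF _ W2]) measurable
    have decomp: "x $ j = - a $ i * x $ i + a \<bullet> (x - \<mu>) + (a \<bullet> \<mu> - (\<Sum>k\<in>C. a $ k * x $ k))" for x
    proof -
      have "a \<bullet> x = (\<Sum>k\<in>insert j ?D. a $ k * x $ k)"
        unfolding inner_vec_def using a_off by (intro sum.mono_neutral_cong_right) auto
      also have "\<dots> = x $ j + a $ i * x $ i + (\<Sum>k\<in>C. a $ k * x $ k)"
        using False assms(10) a_j by (subst sum.insert sum.insert; auto)+
      finally show ?thesis by (simp add: inner_diff_right)
    qed
    show ?thesis
    proof (rule cond_cov_mono_nonneg[OF G F V X2 _ W2, where \<beta> = "- a $ i" and H = ?H])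
      show "AE \<omega> in M. real_cond_exp M ?G ?W \<omega> = 0"
        by (rule cond_exp_residual_eq_0[OF \<open>prob_space M\<close> X rep W1 \<Sigma>a nz])
      show "?H \<in> borel_measurable ?F"
        by (intro borel_measurable_diff borel_measurable_sum borel_measurable_times
            borel_measurable_const component_measurable_sigma_subvector)
      show "integrable M ?H"
        using X1 by auto
      show "0 \<le> - a $ i" using a_D[of i] by simp
    qed (use decomp \<open>mono g\<close> in auto)
  qed
  have MF: "subalgebra M ?F" by (rule subalgebra_sigma_subvector[OF X])
  have "AE \<omega> in M. 0 \<le> cond_cov M ?F (\<lambda>\<omega>. g (X \<omega> $ i)) (\<lambda>\<omega>. g (X \<omega> $ i)) \<omega>"
    "AE \<omega> in M. 0 \<le> cond_cov M ?F (\<lambda>\<omega>. X \<omega> $ j) (\<lambda>\<omega>. X \<omega> $ j) \<omega>"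
    by (rule cond_cov_self_nonneg[OF \<open>prob_space M\<close> MF]; measurable)+
  with cov show ?thesis
    by eventually_elim (auto simp: cond_corr_def cond_corr_defined_def)
qed

end
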